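(* Let $k\ge 2$ and $p_1,\dots,p_k\ge 1$, and let $K_{p_1,\dots,p_k}$ be the complete $k$-partite graph with parts of sizes $p_1,\dots,p_k$. Then $\mathrm{MEG}(K_{p_1,\dots,p_k})=|V(K_{p_1,\dots,p_k})|=p_1+\dots+p_k$, except when the graph is a star $K_{1,p}$ with $p\ge 2$ (i.e. $k=2$ and one part has size $1$ while the other has size $p\ge 2$), in which case $\mathrm{MEG}(K_{1,p})=p$.
   Context: The complete $k$-partite graph $K_{p_1,\dots,p_k}$ has $k$ disjoint vertex sets of sizes $p_1,\dots,p_k$, with an edge between any two vertices in distinct sets and no other edges. Two vertices $x,y$ of a graph $G$ monitor an edge $e$ if $e$ belongs to all shortest paths between $x$ and $y$. A set $S\subseteq V(G)$ is a monitoring edge-geodetic set (MEG-set) if for every edge $e$ of $G$ there is a pair $x,y\in S$ that monitors $e$. $\mathrm{MEG}(G)$ denotes the minimum size of an MEG-set of $G$. *)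

theory Defs
  imports Main "HOL-Library.Disjoint_Sets"
begin

record 'a graph =
  verts :: "'a set"
  edges :: "'a set set"

text \<open>The complete multipartite graph is determined by the part sizes only up to isomorphism.
  The predicate therefore describes all of its copies: \<open>P 1, \<dots>, P k\<close> are the parts.\<close>

definition complete_multipartite :: "nat \<Rightarrow> (nat \<Rightarrow> nat) \<Rightarrow> 'a graph \<Rightarrow> bool" where
  "complete_multipartite k p G \<longleftrightarrow>
     (\<exists>P. disjoint_family_on P {1..k} \<and>
          (\<forall>i\<in>{1..k}. finite (P i) \<and> card (P i) = p i) \<and>
          verts G = (\<Union>i\<in>{1..k}. P i) \<and>
          edges G = {{u, v} | u v i j.
            i \<in> {1..k} \<and> j \<in> {1..k} \<and> i \<noteq> j \<and> u \<in> P i \<and> v \<in> P j})"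

lemma complete_multipartite_exists:
  "\<exists>G :: (nat \<times> nat) graph. complete_multipartite k p G"
proof -
  define P where "P = (\<lambda>i::nat. {i} \<times> {..<p i})"
  have "disjoint_family_on P {1..k}" "\<forall>i\<in>{1..k}. finite (P i) \<and> card (P i) = p i"
    by (auto simp: P_def disjoint_family_on_def card_cartesian_product)
  then have "complete_multipartite k p
      \<lparr>verts = (\<Union>i\<in>{1..k}. P i), edges = {{u, v} | u v i j.
         i \<in> {1..k} \<and> j \<in> {1..k} \<and> i \<noteq> j \<and> u \<in> P i \<and> v \<in> P j}\<rparr>"
    unfolding complete_multipartite_def by (intro exI[of _ P]) simp
  then show ?thesis by blast
qed

text \<open>Paths are nonempty lists of vertices; \<open>[x]\<close> is the trivial path from \<open>x\<close> to \<open>x\<close>.\<close>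

definition path_edges :: "'a list \<Rightarrow> 'a set set" where
  "path_edges xs = {{xs ! i, xs ! Suc i} | i. Suc i < length xs}"

definition is_path :: "'a graph \<Rightarrow> 'a \<Rightarrow> 'a \<Rightarrow> 'a list \<Rightarrow> bool" where
  "is_path G x y xs \<longleftrightarrow>
     xs \<noteq> [] \<and> hd xs = x \<and> last xs = y \<and> distinct xs \<and>
     set xs \<subseteq> verts G \<and> path_edges xs \<subseteq> edges G"

definition shortest_path :: "'a graph \<Rightarrow> 'a \<Rightarrow> 'a \<Rightarrow> 'a list \<Rightarrow> bool" where
  "shortest_path G x y xs \<longleftrightarrow>
     is_path G x y xs \<and> (\<forall>ys. is_path G x y ys \<longrightarrow> length xs \<le> length ys)"

text \<open>The first conjunct only excludes vacuous monitoring by vertices of different connected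
  components; it always holds in a connected graph.\<close>

definition monitors :: "'a graph \<Rightarrow> 'a \<Rightarrow> 'a \<Rightarrow> 'a set \<Rightarrow> bool" where
  "monitors G x y e \<longleftrightarrow>
     (\<exists>xs. is_path G x y xs) \<and> (\<forall>xs. shortest_path G x y xs \<longrightarrow> e \<in> path_edges xs)"

definition MEG_set :: "'a graph \<Rightarrow> 'a set \<Rightarrow> bool" where
  "MEG_set G S \<longleftrightarrow>
     S \<subseteq> verts G \<and> (\<forall>e\<in>edges G. \<exists>x\<in>S. \<exists>y\<in>S. monitors G x y e)"

definition MEG :: "'a graph \<Rightarrow> nat" where
  "MEG G = (LEAST n. \<exists>S. finite S \<and> MEG_set G S \<and> card S = n)"

end

theory Submission imports Defs begin

text \<open>If \<open>x\<close> and \<open>y\<close> are at distance at most two and monitor an edge at a vertex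
  \<open>v \<notin> {x, y}\<close>, then they are distinct, not adjacent, and \<open>v\<close> is their only common neighbour. In a
  complete multipartite graph this says that \<open>x, y\<close> lie in one part and \<open>v\<close> is the only vertex
  outside of it, so the graph is a star with centre \<open>v\<close>. Hence only the centre of a star can be
  missing from an MEG-set. Conversely, any two leaves of a star are joined by a single shortest
  path, which passes through the centre.\<close>

section \<open>Paths with at most three vertices\<close>

text \<open>Recursion on the list replaces the indices of the definition, so that
  \<open>simp\<close> can compute the edges of the short paths that occur below.\<close>

lemma path_edges_simps [simp]:
  "path_edges [] = {}"
  "path_edges [x] = {}"
  "path_edges (x # y # zs) = insert {x, y} (path_edges (y # zs))"
proof -
  show "path_edges (x # y # zs) = insert {x, y} (path_edges (y # zs))"
  proof (intro set_eqI iffI)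
    fix e assume "e \<in> path_edges (x # y # zs)"
    then obtain i where i: "e = {(x # y # zs) ! i, (x # y # zs) ! Suc i}"
      "Suc i < length (x # y # zs)"
      unfolding path_edges_def by blast
    then show "e \<in> insert {x, y} (path_edges (y # zs))"
      by (cases i) (auto simp: path_edges_def)
  next
    fix e assume "e \<in> insert {x, y} (path_edges (y # zs))"
    then consider "e = {x, y}"
      | i where "e = {(y # zs) ! i, (y # zs) ! Suc i}" "Suc i < length (y # zs)"
      unfolding path_edges_def by blast
    then show "e \<in> path_edges (x # y # zs)"
    proof cases
      case 1
      then show ?thesis unfolding path_edges_def by (auto intro!: exI[of _ 0])
    next
      case (2 i)
      then show ?thesis unfolding path_edges_def by (auto intro!: exI[of _ "Suc i"])
    qed
  qed
qed (auto simp: path_edges_def)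

lemma shortest_path_trivial:
  assumes "x \<in> verts G"
  shows "shortest_path G x x [x]"
  using assms by (auto simp: shortest_path_def is_path_def Suc_le_eq)

lemma length_path_ge_2:
  assumes "is_path G x y xs" "x \<noteq> y"
  shows "2 \<le> length xs"
  \<comment> \<open>\<open>remdups_adj.cases\<close> serves as a case split into empty, one-element
    and longer lists.\<close>
  using assms by (cases xs rule: remdups_adj.cases) (auto simp: is_path_def)

lemma length_path_ge_3:
  assumes "is_path G x y xs" "x \<noteq> y" "{x, y} \<notin> edges G"
  shows "3 \<le> length xs"
proof -
  obtain a b zs where xs: "xs = a # b # zs"
    using length_path_ge_2[OF assms(1,2)] by (cases xs rule: remdups_adj.cases) auto
  then show ?thesis using assms by (cases zs) (auto simp: is_path_def)
qed

lemma shortest_path_edge: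
  assumes "x \<in> verts G" "y \<in> verts G" "x \<noteq> y" "{x, y} \<in> edges G"
  shows "shortest_path G x y [x, y]"
proof -
  have "is_path G x y [x, y]" using assms by (simp add: is_path_def)
  then show ?thesis using length_path_ge_2[OF _ assms(3)] by (fastforce simp: shortest_path_def)
qed

lemma is_path_common_neighbour:
  assumes "{x, y, w} \<subseteq> verts G" "x \<noteq> y" "w \<noteq> x" "w \<noteq> y" "{x, w} \<in> edges G" "{w, y} \<in> edges G"
  shows "is_path G x y [x, w, y]"
  using assms by (auto simp: is_path_def)

lemma shortest_path_common_neighbour:
  assumes "{x, y, w} \<subseteq> verts G" "x \<noteq> y" "w \<noteq> x" "w \<noteq> y" "{x, w} \<in> edges G" "{w, y} \<in> edges G"
    and "{x, y} \<notin> edges G"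
  shows "shortest_path G x y [x, w, y]"
  using is_path_common_neighbour[OF assms(1-6)] length_path_ge_3[OF _ assms(2,7)]
  by (fastforce simp: shortest_path_def)

section \<open>Monitoring at distance at most two\<close>

lemma monitorsD:
  assumes "monitors G x y e" "shortest_path G x y xs"
  shows "e \<in> path_edges xs"
  using assms by (auto simp: monitors_def)

lemma not_monitors_refl:
  assumes "x \<in> verts G"
  shows "\<not> monitors G x x e"
  using monitorsD[OF _ shortest_path_trivial[OF assms]] by auto

text \<open>The single edge is the only shortest path between adjacent vertices.\<close>

lemma monitors_edge_iff:
  assumes "x \<in> verts G" "y \<in> verts G" "x \<noteq> y" "{x, y} \<in> edges G"
  shows "monitors G x y e \<longleftrightarrow> e = {x, y}"
proof
  assume "monitors G x y e"
  then show "e = {x, y}" using monitorsD[OF _ shortest_path_edge[OF assms]] by auto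
next
  assume e: "e = {x, y}"
  note sp = shortest_path_edge[OF assms]
  have "e \<in> path_edges xs" if xs: "shortest_path G x y xs" for xs
  proof -
    have "length xs \<le> 2" using xs sp by (force simp: shortest_path_def)
    moreover have "is_path G x y xs" using xs by (simp add: shortest_path_def)
    ultimately show ?thesis using length_path_ge_2[of G x y xs] assms(3) e
      by (cases xs rule: remdups_adj.cases) (auto simp: is_path_def)
  qed
  then show "monitors G x y e" using sp by (auto simp: monitors_def shortest_path_def)
qed

text \<open>Every common neighbour \<open>w\<close> yields a shortest path \<open>[x, w, y]\<close>.
  The monitored edge lies on it, and \<open>w\<close> is the only inner vertex there that
  \<open>v\<close> can be.\<close>

lemma monitors_common_neighbour:
  assumes "{x, y, w} \<subseteq> verts G" "x \<noteq> y" "w \<noteq> x" "w \<noteq> y" "{x, w} \<in> edges G" "{w, y} \<in> edges G"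
    and "{x, y} \<notin> edges G" "monitors G x y e" "v \<in> e" "v \<noteq> x" "v \<noteq> y"
  shows "w = v"
  using monitorsD[OF assms(8) shortest_path_common_neighbour[OF assms(1-7)]] assms(9-11) by auto

text \<open>A shortest path has exactly three vertices here, and its middle one is a common
  neighbour of the ends, hence \<open>w\<close>.\<close>

lemma monitors_unique_common_neighbour:
  assumes "{x, y, w} \<subseteq> verts G" "x \<noteq> y" "w \<noteq> x" "w \<noteq> y" "{x, w} \<in> edges G" "{w, y} \<in> edges G"
    and "{x, y} \<notin> edges G"
    and unique: "\<And>z. \<lbrakk>{x, z} \<in> edges G; {z, y} \<in> edges G\<rbrakk> \<Longrightarrow> z = w"
  shows "monitors G x y {x, w}"
proof -
  note sp = shortest_path_common_neighbour[OF assms(1-7)]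
  have "{x, w} \<in> path_edges xs" if xs: "shortest_path G x y xs" for xs
  proof -
    have "length xs \<le> 3" using xs sp by (force simp: shortest_path_def)
    moreover have path: "is_path G x y xs" using xs by (simp add: shortest_path_def)
    ultimately have "length xs = 3" using length_path_ge_3[OF path assms(2,7)] by simp
    then obtain a b c where "xs = [a, b, c]"
      by (auto simp: numeral_3_eq_3 length_Suc_conv)
    then show ?thesis using path unique[of b] by (auto simp: is_path_def)
  qed
  then show ?thesis using sp by (auto simp: monitors_def shortest_path_def)
qed

lemma MEG_eq_card:
  assumes "finite S" "MEG_set G S"
    and "\<And>T. \<lbrakk>finite T; MEG_set G T\<rbrakk> \<Longrightarrow> card S \<le> card T"
  shows "MEG G = card S"
  unfolding MEG_def using assms by (intro Least_equality) auto

section \<open>Complete multipartite graphs\<close>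

text \<open>One family of parts is fixed, so that arguments can speak of \<open>P i\<close>
  directly; the part sizes are read off as \<open>card (P i)\<close>.\<close>

locale multipartite_graph =
  fixes G :: "'a graph" and k :: nat and P :: "nat \<Rightarrow> 'a set"
  assumes two_le_k: "2 \<le> k"
    and disjoint: "disjoint_family_on P {1..k}"
    and finite_part: "i \<in> {1..k} \<Longrightarrow> finite (P i)"
    and part_nonempty: "i \<in> {1..k} \<Longrightarrow> P i \<noteq> {}"
    and verts_eq: "verts G = (\<Union>i\<in>{1..k}. P i)"
    and edges_eq: "edges G = {{u, v} | u v i j.
      i \<in> {1..k} \<and> j \<in> {1..k} \<and> i \<noteq> j \<and> u \<in> P i \<and> v \<in> P j}"
begin

lemma finite_verts: "finite (verts G)"
  using finite_part by (auto simp: verts_eq)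

lemma card_verts: "card (verts G) = (\<Sum>i=1..k. card (P i))"
  unfolding verts_eq
proof (rule card_UN_disjoint)
  show "\<forall>i\<in>{1..k}. \<forall>j\<in>{1..k}. i \<noteq> j \<longrightarrow> P i \<inter> P j = {}"
    using disjoint by (auto simp: disjoint_family_on_def)
qed (use finite_part in auto)

lemma part_unique:
  assumes "u \<in> P i" "u \<in> P j" "i \<in> {1..k}" "j \<in> {1..k}"
  shows "i = j"
  using disjoint assms unfolding disjoint_family_on_def by blast

lemma edge_iff:
  assumes "u \<in> P i" "v \<in> P j" "i \<in> {1..k}" "j \<in> {1..k}"
  shows "{u, v} \<in> edges G \<longleftrightarrow> i \<noteq> j"
proof
  assume "{u, v} \<in> edges G"
  then obtain a b i' j' where "{u, v} = {a, b}" "i' \<in> {1..k}" "j' \<in> {1..k}" "i' \<noteq> j'"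
    "a \<in> P i'" "b \<in> P j'"
    unfolding edges_eq by blast
  then show "i \<noteq> j" using part_unique assms by (metis doubleton_eq_iff)
next
  assume "i \<noteq> j"
  then show "{u, v} \<in> edges G" unfolding edges_eq using assms by blast
qed

lemma other_part:
  obtains j where "j \<in> {1..k}" "j \<noteq> i"
proof (cases "i = 1")
  case True
  then show ?thesis using two_le_k by (intro that[of 2]) auto
next
  case False
  then show ?thesis using two_le_k by (intro that[of 1]) auto
qed

text \<open>Each edge is monitored by its own two ends.\<close>

lemma MEG_set_verts: "MEG_set G (verts G)"
  unfolding MEG_set_def
proof (intro conjI ballI)
  fix e assume "e \<in> edges G"
  then obtain u v i j where e: "e = {u, v}" "i \<in> {1..k}" "j \<in> {1..k}" "i \<noteq> j" "u \<in> P i" "v \<in> P j"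
    unfolding edges_eq by blast
  have uv: "u \<in> verts G" "v \<in> verts G" using e by (auto simp: verts_eq)
  have "u \<noteq> v" using e part_unique by blast
  then have "monitors G u v e"
    using monitors_edge_iff[of u G v e] e edge_iff[of u i v j] uv by auto
  then show "\<exists>x\<in>verts G. \<exists>y\<in>verts G. monitors G x y e" using uv by blast
qed simp

text \<open>Some edge at \<open>v\<close> must be monitored by two vertices other than
  \<open>v\<close>. Adjacent vertices monitor only the edge between them, so these two lie in a
  common part \<open>P m\<close>.\<close>

lemma not_in_MEG_set:
  assumes "MEG_set G S" "v \<in> verts G" "v \<notin> S"
  obtains m where "m \<in> {1..k}" "verts G - P m = {v}" "2 \<le> card (P m)"
proof -
  obtain i where i: "i \<in> {1..k}" "v \<in> P i" using assms(2) by (auto simp: verts_eq)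
  obtain j where j: "j \<in> {1..k}" "j \<noteq> i" by (rule other_part)
  obtain u where u: "u \<in> P j" using part_nonempty j by blast
  have "{u, v} \<in> edges G" using edge_iff i j u by blast
  then obtain x y where xy: "x \<in> S" "y \<in> S" and mon: "monitors G x y {u, v}"
    using assms(1) by (auto simp: MEG_set_def)
  have xyV: "x \<in> verts G" "y \<in> verts G" and vxy: "v \<noteq> x" "v \<noteq> y"
    using xy assms by (auto simp: MEG_set_def)
  have "x \<noteq> y" using mon not_monitors_refl xyV by metis
  have nonadj: "{x, y} \<notin> edges G"
    using monitors_edge_iff[OF xyV \<open>x \<noteq> y\<close>] mon vxy by (metis insertCI insertE singletonD)
  obtain m m' where "m \<in> {1..k}" "x \<in> P m" "m' \<in> {1..k}" "y \<in> P m'"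
    using xyV by (auto simp: verts_eq)
  with nonadj have m: "m \<in> {1..k}" "x \<in> P m" "y \<in> P m" using edge_iff by blast+
  \<comment> \<open>Any vertex outside \<open>P m\<close> is a common neighbour of \<open>x\<close>
    and \<open>y\<close>.\<close>
  have eq_v: "w = v" if w: "w \<in> verts G - P m" for w
  proof -
    obtain n where n: "n \<in> {1..k}" "w \<in> P n" "n \<noteq> m"
      using w unfolding verts_eq by blast
    have "{x, w} \<in> edges G" "{w, y} \<in> edges G" using edge_iff n m by blast+
    moreover have "w \<noteq> x" "w \<noteq> y" using w m by auto
    ultimately show ?thesis
      using monitors_common_neighbour[OF _ \<open>x \<noteq> y\<close> _ _ _ _ nonadj mon] w xyV vxy by auto
  qed
  \<comment> \<open>So far \<open>verts G - P m\<close> is only known to be contained in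
    \<open>{v}\<close>; a second nonempty part shows that it is not empty.\<close>
  obtain n where n: "n \<in> {1..k}" "n \<noteq> m" by (rule other_part)
  obtain w where w: "w \<in> P n" using part_nonempty n by blast
  have "w \<in> verts G - P m" using n w m part_unique by (auto simp: verts_eq)
  with eq_v have "verts G - P m = {v}" by blast
  moreover have "card {x, y} \<le> card (P m)" using m finite_part by (intro card_mono) auto
  ultimately show ?thesis using that m(1) \<open>x \<noteq> y\<close> by auto
qed

text \<open>All parts other than \<open>P m\<close> are nonempty subsets of \<open>{v}\<close>, and
  disjointness leaves room for only one of them.\<close>

lemma star_if_one_vertex_outside:
  assumes "m \<in> {1..k}" "verts G - P m = {v}"
  shows "k = 2 \<and> (\<forall>i\<in>{1..k} - {m}. P i = {v})"
proof -
  have other: "P i = {v}" if "i \<in> {1..k}" "i \<noteq> m" for i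
  proof -
    have "P i \<subseteq> verts G - P m" using that assms(1) part_unique by (auto simp: verts_eq)
    then show ?thesis using assms(2) part_nonempty[OF that(1)] by auto
  qed
  have "k = 2"
  proof (rule ccontr)
    assume "k \<noteq> 2"
    then have "{1, 2, 3} \<subseteq> {1..k}" using two_le_k by auto
    \<comment> \<open>With three parts, two different ones besides \<open>P m\<close> would both
      equal \<open>{v}\<close>.\<close>
    moreover have "\<exists>i\<in>{1, 2, 3}. \<exists>j\<in>{1, 2, 3}. i \<noteq> j \<and> i \<noteq> m \<and> j \<noteq> m"
      by (cases "m = 1"; cases "m = 2") auto
    then obtain i j where ij: "i \<in> {1, 2, 3}" "j \<in> {1, 2, 3}" "i \<noteq> j" "i \<noteq> m" "j \<noteq> m"
      by blast
    ultimately have "i \<in> {1..k}" "j \<in> {1..k}" by blast+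
    then show False using other[of i] other[of j] part_unique[of v i j] ij by simp
  qed
  then show ?thesis using other by blast
qed

text \<open>The assumption excludes stars with at least two leaves but admits a single edge. A
  vertex missing from an MEG-set would make the graph such a star.\<close>

lemma MEG_eq_card_verts:
  assumes "\<And>i j. \<lbrakk>k = 2; {i, j} = {1, 2}; card (P i) = 1\<rbrakk> \<Longrightarrow> card (P j) < 2"
  shows "MEG G = card (verts G)"
proof (rule MEG_eq_card[OF finite_verts MEG_set_verts])
  fix T assume T: "finite T" "MEG_set G T"
  have "v \<in> T" if v: "v \<in> verts G" for v
  proof (rule ccontr)
    assume "v \<notin> T"
    then obtain m where m: "m \<in> {1..k}" "verts G - P m = {v}" "2 \<le> card (P m)"
      using not_in_MEG_set T(2) v by blast
    obtain i where i: "i \<in> {1..k}" "i \<noteq> m" by (rule other_part)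
    have "k = 2" "P i = {v}" using star_if_one_vertex_outside[OF m(1,2)] i by auto
    moreover from this have "{i, m} = {1, 2}" using i m(1) by auto
    ultimately show False using assms[of i m] m(3) by simp
  qed
  then show "card (verts G) \<le> card T" using T(1) by (intro card_mono) auto
qed

text \<open>\<open>P i\<close> holds the centre and \<open>P j\<close> the leaves; the indices are
  left open so that either part may be the singleton.\<close>

lemma MEG_star:
  assumes "k = 2" "{i, j} = {1, 2}" "card (P i) = 1" "2 \<le> card (P j)"
  shows "MEG G = card (P j)"
proof (rule MEG_eq_card)
  have ij: "i \<in> {1..k}" "j \<in> {1..k}" "i \<noteq> j" and k_eq: "{1..k} = {i, j}"
    using assms(1,2) by (auto simp: doubleton_eq_iff)
  show "finite (P j)" using finite_part ij by blast
  obtain c where c: "P i = {c}" using assms(3) card_1_singletonE by blast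
  show "MEG_set G (P j)"
    unfolding MEG_set_def
  proof (intro conjI ballI)
    show "P j \<subseteq> verts G" using ij by (auto simp: verts_eq)
    fix e assume "e \<in> edges G"
    then obtain x where x: "x \<in> P j" "e = {x, c}"
      unfolding edges_eq k_eq using c by (auto simp: insert_commute)
    \<comment> \<open>Two leaves are needed: the edge from \<open>x\<close> to the centre is
      monitored by \<open>x\<close> and any second leaf \<open>y\<close>.\<close>
    have "card (P j) \<le> card {x}" if "P j \<subseteq> {x}"
      using that by (intro card_mono) auto
    then obtain y where y: "y \<in> P j" "y \<noteq> x"
      using assms(4) by force
    have neighbour: "z = c" if z: "{x, z} \<in> edges G" for z
    proof -
      have "z \<in> P i \<or> z \<in> P j" using z unfolding edges_eq k_eq by (auto simp: doubleton_eq_iff)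
      then show ?thesis using c edge_iff[OF x(1) _ ij(2) ij(2)] z by auto
    qed
    have "monitors G x y {x, c}"
    proof (rule monitors_unique_common_neighbour)
      show "{x, y, c} \<subseteq> verts G" using x y c ij by (auto simp: verts_eq)
      show "c \<noteq> x" "c \<noteq> y" using part_unique x y c ij by blast+
      show "{x, c} \<in> edges G" "{c, y} \<in> edges G" "{x, y} \<notin> edges G"
        using edge_iff x y c ij by blast+
    qed (use y neighbour in auto)
    then show "\<exists>x\<in>P j. \<exists>y\<in>P j. monitors G x y e" using x y by blast
  qed
  fix T assume T: "finite T" "MEG_set G T"
  have "v \<in> T" if v: "v \<in> P j" for v
  proof (rule ccontr)
    assume "v \<notin> T"
    moreover have "v \<in> verts G" using v ij by (auto simp: verts_eq)
    ultimately obtain m where m: "m \<in> {1..k}" "verts G - P m = {v}" "2 \<le> card (P m)"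
      using not_in_MEG_set T(2) by blast
    \<comment> \<open>The leaf \<open>v\<close> lies in \<open>P j\<close> but outside
      \<open>P m\<close>, so \<open>P m\<close> is the centre part, which is too small.\<close>
    then have "m = i" using v k_eq by auto
    then show False using m assms(3) by simp
  qed
  then show "card (P j) \<le> card T" using T(1) by (intro card_mono) auto
qed

end

theorem theorem5:
  fixes G :: "'a graph" and k :: nat and p :: "nat \<Rightarrow> nat"
  assumes "k \<ge> 2"
    and "\<forall>i\<in>{1..k}. p i \<ge> 1"
    and "complete_multipartite k p G"
  shows "card (verts G) = (\<Sum>i=1..k. p i) \<and>
    (\<not> (k = 2 \<and> (\<exists>q\<ge>2. (p 1 = 1 \<and> p 2 = q) \<or> (p 1 = q \<and> p 2 = 1)))
       \<longrightarrow> MEG G = card (verts G)) \<and>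
    (\<forall>q\<ge>2. k = 2 \<and> ((p 1 = 1 \<and> p 2 = q) \<or> (p 1 = q \<and> p 2 = 1)) \<longrightarrow> MEG G = q)"
proof -
  obtain P where P: "disjoint_family_on P {1..k}"
    "\<forall>i\<in>{1..k}. finite (P i) \<and> card (P i) = p i"
    "verts G = (\<Union>i\<in>{1..k}. P i)"
    "edges G = {{u, v} | u v i j. i \<in> {1..k} \<and> j \<in> {1..k} \<and> i \<noteq> j \<and> u \<in> P i \<and> v \<in> P j}"
    using assms(3) unfolding complete_multipartite_def by (elim exE conjE) rule
  interpret multipartite_graph G k P
  proof
    fix i assume "i \<in> {1..k}"
    then have "finite (P i)" "1 \<le> card (P i)" using P(2) assms(2) by simp_all
    then show "finite (P i)" "P i \<noteq> {}" by auto
  qed (fact assms(1) P)+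
  have p: "card (P i) = p i" if "i \<in> {1..k}" for i using P(2) that by blast
  show ?thesis
  proof (intro conjI impI allI)
    show "card (verts G) = (\<Sum>i=1..k. p i)" using card_verts p by simp
  next
    assume "\<not> (k = 2 \<and> (\<exists>q\<ge>2. (p 1 = 1 \<and> p 2 = q) \<or> (p 1 = q \<and> p 2 = 1)))"
    then have "\<not> (k = 2 \<and> (p 1 = 1 \<and> 2 \<le> p 2 \<or> 2 \<le> p 1 \<and> p 2 = 1))" by blast
    then show "MEG G = card (verts G)"
      using p by (intro MEG_eq_card_verts) (auto simp: doubleton_eq_iff not_le)
  next
    fix q :: nat
    assume "2 \<le> q" "k = 2 \<and> ((p 1 = 1 \<and> p 2 = q) \<or> (p 1 = q \<and> p 2 = 1))"
    \<comment> \<open>The two instances correspond to the two possible positions of the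
      centre.\<close>
    then show "MEG G = q" using MEG_star[of 1 2] MEG_star[of 2 1] p[of 1] p[of 2] by auto
  qed
qed

end
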